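(* For every integer $n\ge0$ there is a polynomial $P_n(t)$ of degree $n$ such that for all $x\in\mathbb{R}$ $$\sin[(2n+1)x]=P_n(\sin^2(x))\sin(x),$$ $$\cos[(2n+1)x]=(-1)^nP_n(\cos^2(x))\cos(x).$$ *)

theory Defs
  imports Complex_Main "HOL-Computational_Algebra.Polynomial"
begin

end

theory Submission
  imports Defs
begin

text \<open>
  By the product-to-sum formula,
  \<open>sin ((2n + 5) x) + sin ((2n + 1) x) = 2 cos (2x) sin ((2n + 3) x)\<close>, and
  \<open>2 cos (2x) = 2 - 4 sin\<^sup>2 x\<close> is a linear polynomial in \<open>t = sin\<^sup>2 x\<close>. Hence the quotients
  \<open>sin ((2n + 1) x) / sin x\<close> are polynomials in \<open>t\<close> satisfying a three-term recurrence, in which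
  each step multiplies by a linear factor and so raises the degree by exactly one.

  The cosine identity is the sine identity at the complementary angle \<open>\<pi>/2 - x\<close>: this
  substitution exchanges \<open>sin x\<close> and \<open>cos x\<close>, while on the left
  \<open>(2n + 1) (\<pi>/2 - x) = n \<pi> + \<pi>/2 - (2n + 1) x\<close>, and the multiple \<open>n \<pi>\<close> produces the
  sign \<open>(-1)\<^sup>n\<close>.
\<close>

fun odd_sin_poly :: "nat \<Rightarrow> real poly" where
  "odd_sin_poly 0 = 1"
| "odd_sin_poly (Suc 0) = [:3, - 4:]"
| "odd_sin_poly (Suc (Suc n)) = [:2, - 4:] * odd_sin_poly (Suc n) - odd_sin_poly n"

text \<open>
  The linear factor pushes the first term of the recurrence two degrees above the second, so the
  leading terms cannot cancel.
\<close>

lemma degree_odd_sin_poly: "degree (odd_sin_poly n) = n"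
proof (induction n rule: odd_sin_poly.induct)
  case (3 n)
  have "odd_sin_poly (Suc n) \<noteq> 0"
    using 3 by auto
  then have "degree ([:2, - 4:] * odd_sin_poly (Suc n)) = Suc (Suc n)"
    using 3 by (subst degree_mult_eq) auto
  moreover have "degree (- odd_sin_poly n) < Suc (Suc n)"
    using 3 by simp
  ultimately show ?case
    using degree_add_eq_left[of "- odd_sin_poly n" "[:2, - 4:] * odd_sin_poly (Suc n)"]
    by simp
qed simp_all

lemma sin_odd_multiple:
  "sin ((2 * real n + 1) * x) = poly (odd_sin_poly n) ((sin x)\<^sup>2) * sin x"
proof (induction n rule: odd_sin_poly.induct)
  case 1
  then show ?case by simp
next
  case 2
  have "sin (3 * x) = sin (2 * x + x)"
    by simp
  also have "\<dots> = 2 * sin x * (cos x)\<^sup>2 + (1 - 2 * (sin x)\<^sup>2) * sin x"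
    unfolding sin_add sin_double cos_double_sin by (simp add: power2_eq_square)
  also have "\<dots> = (3 - 4 * (sin x)\<^sup>2) * sin x"
    unfolding cos_squared_eq by (simp add: algebra_simps)
  finally show ?case
    by (simp add: mult.commute)
next
  case (3 n)
  define y where "y = (2 * real (Suc n) + 1) * x"
  have up: "(2 * real (Suc (Suc n)) + 1) * x = y + 2 * x"
    and down: "(2 * real n + 1) * x = y - 2 * x"
    by (simp_all add: y_def algebra_simps)
  have "sin (y + 2 * x) = 2 * cos (2 * x) * sin y - sin (y - 2 * x)"
    by (simp add: sin_add sin_diff)
  also have "\<dots> = (2 - 4 * (sin x)\<^sup>2) * sin y - sin (y - 2 * x)"
    by (simp add: cos_double_sin)
  finally show ?case
    using 3 unfolding up down y_def[symmetric] by (simp add: algebra_simps)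
qed

lemma sin_odd_multiple_complement:
  "sin ((2 * real n + 1) * (pi / 2 - x)) = (- 1) ^ n * cos ((2 * real n + 1) * x)"
proof -
  have "(2 * real n + 1) * (pi / 2 - x) = pi / 2 - ((2 * real n + 1) * x - real n * pi)"
    by (simp add: field_simps)
  then have "sin ((2 * real n + 1) * (pi / 2 - x)) = cos ((2 * real n + 1) * x - real n * pi)"
    by (simp only: cos_sin_eq of_real_eq_id id_apply)
  then show ?thesis
    by (simp add: cos_diff)
qed

theorem theorem2p1:
  fixes n :: nat
  shows "\<exists>P :: real poly. degree P = n \<and>
    (\<forall>x::real.
      sin ((2 * real n + 1) * x) = poly P ((sin x)\<^sup>2) * sin x \<and>
      cos ((2 * real n + 1) * x) = (- 1) ^ n * poly P ((cos x)\<^sup>2) * cos x)"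
proof (intro exI[of _ "odd_sin_poly n"] conjI allI)
  fix x :: real
  have "(- 1) ^ n * cos ((2 * real n + 1) * x) = poly (odd_sin_poly n) ((cos x)\<^sup>2) * cos x"
    using sin_odd_multiple[of n "pi / 2 - x"]
    by (simp only: sin_odd_multiple_complement cos_sin_eq[of x] of_real_eq_id id_apply)
  then have "(- 1) ^ n * ((- 1) ^ n * cos ((2 * real n + 1) * x)) =
      (- 1) ^ n * poly (odd_sin_poly n) ((cos x)\<^sup>2) * cos x"
    by simp
  then show "cos ((2 * real n + 1) * x) = (- 1) ^ n * poly (odd_sin_poly n) ((cos x)\<^sup>2) * cos x"
    by (simp add: mult.assoc[symmetric] power_mult_distrib[symmetric])
qed (simp_all only: degree_odd_sin_poly sin_odd_multiple)

end
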